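(* Let $\mathbf{k}$ be an algebraically closed field of characteristic zero and let $\mathbf{A}$ be a $2$-dimensional terminal algebra over $\mathbf{k}$ with nonzero multiplication. Then $\mathbf{A}$ is isomorphic to one of the following pairwise non-isomorphic algebras (distinct names, or distinct admissible parameter values of one name, give non-isomorphic algebras). Each algebra has basis $e_1,e_2$, and products of basis vectors that are not listed are zero: - $\mathfrak{T}_{01}$: $e_1e_1=e_1+e_2,\ e_1e_2=e_2$; - $\mathfrak{T}_{02}$: $e_1e_1=e_1+e_2,\ e_1e_2=2e_2,\ e_2e_1=-e_2$; - $\mathfrak{T}_{03}$: $e_1e_1=e_2$; - $\mathfrak{T}_{04}$: $e_2e_1=e_1$; - $\mathfrak{T}_{05}$: $e_1e_2=2e_1,\ e_2e_1=-e_1$; - $\mathfrak{T}_{06}$: $e_1e_2=e_2,\ e_2e_1=-e_2$; - $\mathfrak{T}_{07}(\alpha)$, $\alpha\in\mathbf{k}\setminus\{1\}$: $e_1e_1=e_1,\ e_1e_2=\alpha e_2$; - $\mathfrak{T}_{08}(\alpha)$, $\alpha\in\mathbf{k}\setminus\{2,\frac32\}$: $e_1e_1=e_1,\ e_1e_2=\alpha e_2,\ e_2e_1=(3-2\alpha)e_2$; - $\mathfrak{T}_{09}$: $e_1e_1=e_1,\ e_2e_2=e_2$; - $\mathfrak{T}_{10}(\alpha)$, $\alpha\in\mathbf{k}$: $e_1e_1=e_1,\ e_1e_2=(1-\alpha)e_1+\alpha e_2,\ e_2e_1=\alpha e_1+(1-\alpha)e_2,\ e_2e_2=e_2$.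
   Context: An algebra $(\mathbb{V},\mathcal{P})$ is a vector space $\mathbb{V}$ over $\mathbf{k}$ with a bilinear multiplication $\mathcal{P}:\mathbb{V}\times\mathbb{V}\to\mathbb{V}$ (no identities assumed). Brackets are defined as follows. For a bilinear map $\mathcal{A}$ and $a\in\mathbb V$, $[\mathcal{A},a]$ is the linear map $[\mathcal A,a](x)=\mathcal{A}(a,x)$. For a linear map $\mathcal{A}$ and a bilinear map $\mathcal{B}$, $[\mathcal A,\mathcal B]$ is the bilinear map $$[\mathcal{A},\mathcal{B}](x,y)=\mathcal{A}(\mathcal{B}(x,y))-\mathcal{B}(\mathcal{A}(x),y)-\mathcal{B}(x,\mathcal{A}(y)).$$ For bilinear maps $\mathcal{A},\mathcal{B}$, $[\mathcal A,\mathcal B]$ is the trilinear map $$[\mathcal A,\mathcal B](x,y,z)=\mathcal A(\mathcal B(x,y),z)+\mathcal A(x,\mathcal B(y,z))+\mathcal A(y,\mathcal B(x,z))-\mathcal B(\mathcal A(x,y),z)-\mathcal B(x,\mathcal A(y,z))-\mathcal B(y,\mathcal A(x,z)).$$ Terminal algebra: $(\mathbb V,\mathcal P)$ is terminal if $[[[\mathcal{P},a],\mathcal{P}],\mathcal{P}]=0$ for every $a\in\mathbb V$. *)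

theory Defs
  imports
    "HOL-Analysis.Cartesian_Space"
    "HOL-Computational_Algebra.Polynomial"
begin

text \<open>Here an algebra is a vector space (the whole type \<open>'v\<close>) with a bilinear product; no identities
  are assumed.\<close>

locale nonassoc_algebra = vector_space scale
  for scale :: "'k::field \<Rightarrow> 'v::ab_group_add \<Rightarrow> 'v" +
  fixes mult :: "'v \<Rightarrow> 'v \<Rightarrow> 'v"
  assumes linear_mult_left: "Vector_Spaces.linear scale scale (\<lambda>x. mult x y)"
    and linear_mult_right: "Vector_Spaces.linear scale scale (\<lambda>y. mult x y)"

definition algebra_iso ::
  "('k::field \<Rightarrow> 'v::ab_group_add \<Rightarrow> 'v) \<Rightarrow> ('v \<Rightarrow> 'v \<Rightarrow> 'v) \<Rightarrow>
   ('k \<Rightarrow> 'w::ab_group_add \<Rightarrow> 'w) \<Rightarrow> ('w \<Rightarrow> 'w \<Rightarrow> 'w) \<Rightarrow> bool" where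
  "algebra_iso s1 P s2 Q \<longleftrightarrow>
     (\<exists>f. Vector_Spaces.linear s1 s2 f \<and> bij f \<and> (\<forall>x y. f (P x y) = Q (f x) (f y)))"

text \<open>The bracket depends on the arities of its arguments; the indices record them (a vector has
  arity 0).\<close>

definition bracket20 :: "('v \<Rightarrow> 'v \<Rightarrow> 'v) \<Rightarrow> 'v \<Rightarrow> ('v \<Rightarrow> 'v)" where
  "bracket20 A a = (\<lambda>x. A a x)"

definition bracket12 ::
  "('v::ab_group_add \<Rightarrow> 'v) \<Rightarrow> ('v \<Rightarrow> 'v \<Rightarrow> 'v) \<Rightarrow> ('v \<Rightarrow> 'v \<Rightarrow> 'v)" where
  "bracket12 A B = (\<lambda>x y. A (B x y) - B (A x) y - B x (A y))"

definition bracket22 ::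
  "('v::ab_group_add \<Rightarrow> 'v \<Rightarrow> 'v) \<Rightarrow> ('v \<Rightarrow> 'v \<Rightarrow> 'v) \<Rightarrow> ('v \<Rightarrow> 'v \<Rightarrow> 'v \<Rightarrow> 'v)" where
  "bracket22 A B = (\<lambda>x y z.
     A (B x y) z + A x (B y z) + A y (B x z) - B (A x y) z - B x (A y z) - B y (A x z))"

definition terminal :: "('v::ab_group_add \<Rightarrow> 'v \<Rightarrow> 'v) \<Rightarrow> bool" where
  "terminal P \<longleftrightarrow> (\<forall>a. bracket22 (bracket12 (bracket20 P a) P) P = (\<lambda>x y z. 0))"

abbreviation e1 :: "'k::field ^ 2" where "e1 \<equiv> axis 1 1"
abbreviation e2 :: "'k::field ^ 2" where "e2 \<equiv> axis 2 1"

text \<open>\<open>structure_mult u11 u12 u21 u22\<close> is the bilinear product on \<open>'k ^ 2\<close> whose value at the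
  \<open>i\<close>-th and \<open>j\<close>-th basis vector is \<open>uij\<close>.\<close>

definition structure_mult ::
  "'k::field ^ 2 \<Rightarrow> 'k ^ 2 \<Rightarrow> 'k ^ 2 \<Rightarrow> 'k ^ 2 \<Rightarrow> 'k ^ 2 \<Rightarrow> 'k ^ 2 \<Rightarrow> 'k ^ 2" where
  "structure_mult u11 u12 u21 u22 x y =
     (x $ 1 * y $ 1) *s u11 + (x $ 1 * y $ 2) *s u12 +
     (x $ 2 * y $ 1) *s u21 + (x $ 2 * y $ 2) *s u22"

lemma structure_mult_basis:
  "structure_mult u11 u12 u21 u22 e1 e1 = u11"
  "structure_mult u11 u12 u21 u22 e1 e2 = u12"
  "structure_mult u11 u12 u21 u22 e2 e1 = u21"
  "structure_mult u11 u12 u21 u22 e2 e2 = u22"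
  by (simp_all add: structure_mult_def axis_def)

lemma nonassoc_algebra_structure_mult:
  "nonassoc_algebra (*s) (structure_mult u11 u12 u21 u22)"
  by unfold_locales (simp_all add: structure_mult_def vec_eq_iff algebra_simps)

datatype 'k terminal_name =
  T01 | T02 | T03 | T04 | T05 | T06 | T07 'k | T08 'k | T09 | T10 'k

fun admissible :: "'k::field terminal_name \<Rightarrow> bool" where
  "admissible (T07 \<alpha>) \<longleftrightarrow> \<alpha> \<noteq> 1"
| "admissible (T08 \<alpha>) \<longleftrightarrow> \<alpha> \<noteq> 2 \<and> \<alpha> \<noteq> 3 / 2"
| "admissible _ \<longleftrightarrow> True"

fun terminal_mult :: "'k::field terminal_name \<Rightarrow> 'k ^ 2 \<Rightarrow> 'k ^ 2 \<Rightarrow> 'k ^ 2" where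
  "terminal_mult T01 = structure_mult (e1 + e2) e2 0 0"
| "terminal_mult T02 = structure_mult (e1 + e2) (2 *s e2) (- e2) 0"
| "terminal_mult T03 = structure_mult e2 0 0 0"
| "terminal_mult T04 = structure_mult 0 0 e1 0"
| "terminal_mult T05 = structure_mult 0 (2 *s e1) (- e1) 0"
| "terminal_mult T06 = structure_mult 0 e2 (- e2) 0"
| "terminal_mult (T07 \<alpha>) = structure_mult e1 (\<alpha> *s e2) 0 0"
| "terminal_mult (T08 \<alpha>) = structure_mult e1 (\<alpha> *s e2) ((3 - 2 * \<alpha>) *s e2) 0"
| "terminal_mult T09 = structure_mult e1 0 0 e2"
| "terminal_mult (T10 \<alpha>) =
     structure_mult e1 ((1 - \<alpha>) *s e1 + \<alpha> *s e2) (\<alpha> *s e1 + (1 - \<alpha>) *s e2) e2"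

end

theory Submission
  imports Defs
begin

text \<open>
  Over an algebraically closed field some \<open>x \<noteq> 0\<close> satisfies \<open>x x = \<lambda> x\<close>, so one structure constant of
  a plane algebra can be made to vanish and \<open>\<lambda>\<close> can be taken to be \<open>1\<close> or \<open>0\<close>. The terminal identity,
  evaluated on basis vectors, then forces either two orthogonal idempotents (\<open>T09\<close>) or a normal form
  \<open>e e = \<epsilon> e + \<delta> n\<close>, \<open>e n = \<alpha> n\<close>, \<open>n e = \<beta> n\<close>, \<open>n n = 0\<close>, in which it amounts to
  \<open>\<beta> (2 \<alpha> + \<beta> - 3 \<epsilon>) (\<alpha> + \<beta> - \<epsilon>) = 0\<close> and \<open>\<delta> \<beta> (2 \<alpha> + \<beta> - 3 \<epsilon>) = 0\<close>.
  A change of basis scales \<open>(\<epsilon>, \<alpha>, \<beta>)\<close>, scales \<open>\<delta>\<close> independently and, unless \<open>\<alpha> + \<beta> = \<epsilon>\<close>,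
  removes \<open>\<delta>\<close>; conversely, for a nonzero product these are the only ambiguities of the normal
  form, so its parameters separate the algebras of the list. \<open>T09\<close> is set apart by having no square-zero vector other than \<open>0\<close>.
\<close>

section \<open>Coordinates, bases and multiplication tables in a plane\<close>

definition comb :: "('k \<Rightarrow> 'v \<Rightarrow> 'v::ab_group_add) \<Rightarrow> 'v \<Rightarrow> 'v \<Rightarrow> 'k \<times> 'k \<Rightarrow> 'v" where
  "comb s u v = (\<lambda>(a, b). s a u + s b v)"

lemma comb_pair: "comb s u v (a, b) = s a u + s b v"
  by (simp add: comb_def)

text \<open>Bijectivity of the coordinate map packs independence and spanning into one statement, so
  coordinates can be compared as pairs and bases transported by composing maps.\<close>

definition basis_pair :: "('k \<Rightarrow> 'v \<Rightarrow> 'v::ab_group_add) \<Rightarrow> 'v \<Rightarrow> 'v \<Rightarrow> bool" where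
  "basis_pair s u v \<longleftrightarrow> bij (comb s u v)"

definition has_table :: "('k \<Rightarrow> 'v \<Rightarrow> 'v::ab_group_add) \<Rightarrow> ('v \<Rightarrow> 'v \<Rightarrow> 'v) \<Rightarrow> 'v \<Rightarrow> 'v \<Rightarrow>
    'k \<times> 'k \<Rightarrow> 'k \<times> 'k \<Rightarrow> 'k \<times> 'k \<Rightarrow> 'k \<times> 'k \<Rightarrow> bool" where
  "has_table s P u v A B C D \<longleftrightarrow> basis_pair s u v \<and>
     P u u = comb s u v A \<and> P u v = comb s u v B \<and> P v u = comb s u v C \<and> P v v = comb s u v D"

context vector_space
begin

lemma comb_add: "comb scale u v (a, b) + comb scale u v (c, d) = comb scale u v (a + c, b + d)"
  by (simp add: comb_pair algebra_simps)

lemma comb_diff: "comb scale u v (a, b) - comb scale u v (c, d) = comb scale u v (a - c, b - d)"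
  by (simp add: comb_pair algebra_simps)

lemma comb_scale: "scale c (comb scale u v (a, b)) = comb scale u v (c * a, c * b)"
  by (simp add: comb_pair algebra_simps)

lemma comb_comb:
  "comb scale (comb scale u v (x1, x2)) (comb scale u v (y1, y2)) (a, b) =
    comb scale u v (a * x1 + b * y1, a * x2 + b * y2)"
  by (simp add: comb_pair[of _ "comb _ _ _ _"] comb_scale comb_add)

lemma comb_0: "comb scale u v (0, 0) = 0"
  by (simp add: comb_pair)

lemma comb_eq_iff:
  "basis_pair scale u v \<Longrightarrow> comb scale u v p = comb scale u v q \<longleftrightarrow> p = q"
  by (auto simp: basis_pair_def bij_def dest: injD)

lemma comb_eq_0_iff:
  "basis_pair scale u v \<Longrightarrow> comb scale u v p = 0 \<longleftrightarrow> p = (0, 0)"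
  using comb_eq_iff[of u v p "(0, 0)"] by (simp add: comb_0)

lemma comb_cases:
  assumes "basis_pair scale u v"
  obtains a b where "x = comb scale u v (a, b)"
  using assms by (metis basis_pair_def bij_pointE surj_pair)

lemma basis_pairI:
  assumes "\<And>a b. scale a u + scale b v = 0 \<Longrightarrow> a = 0 \<and> b = 0"
    and "\<And>x. \<exists>a b. x = scale a u + scale b v"
  shows "basis_pair scale u v"
  unfolding basis_pair_def bij_def
proof
  show "inj (comb scale u v)"
  proof (rule injI, clarify)
    fix a b c d
    assume "comb scale u v (a, b) = comb scale u v (c, d)"
    then have "comb scale u v (a - c, b - d) = 0"
      by (simp flip: comb_diff)
    then show "a = c \<and> b = d"
      using assms(1)[of "a - c" "b - d"] by (simp add: comb_pair)
  qed
  show "surj (comb scale u v)"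
    using assms(2) by (auto simp: surj_def comb_pair)
qed

lemma basis_pair_exists:
  assumes "dim UNIV = 2"
  obtains u v where "basis_pair scale u v"
proof -
  obtain B where B: "independent B" "UNIV \<subseteq> span B" "card B = 2"
    using basis_exists[of UNIV] assms by metis
  then obtain u v where uv: "B = {u, v}" "u \<noteq> v"
    by (auto simp: card_2_iff)
  have nv: "u \<notin> span {v}" "v \<notin> span {u}"
    using B(1) uv by (auto simp: dependent_def insert_Diff_if)
  have v0: "v \<noteq> 0" using nv(2) span_zero by blast
  have "basis_pair scale u v"
  proof (rule basis_pairI)
    fix a b assume eq: "scale a u + scale b v = 0"
    have "a = 0"
    proof (rule ccontr)
      assume "a \<noteq> 0"
      moreover have "scale a u = scale (- b) v"
        using eq by (simp add: eq_neg_iff_add_eq_0)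
      ultimately have "u = scale (- b / a) v"
        by (metis divide_inverse mult.commute scale_one scale_scale right_inverse)
      with nv(1) show False
        unfolding span_singleton by blast
    qed
    then show "a = 0 \<and> b = 0" using eq v0 by simp
  next
    fix x
    have "x \<in> span {u, v}" using B uv by auto
    then obtain a b where "x - scale a u = scale b v"
      by (auto simp: span_insert span_singleton)
    then show "\<exists>a b. x = scale a u + scale b v"
      by (metis add.commute diff_add_cancel)
  qed
  then show thesis using that by blast
qed

lemma basis_pair_change:
  assumes "basis_pair scale u v" and "a * d - b * c \<noteq> 0"
  shows "basis_pair scale (comb scale u v (a, b)) (comb scale u v (c, d))"
proof (rule basis_pairI)
  let ?D = "a * d - b * c"
  fix x y assume "scale x (comb scale u v (a, b)) + scale y (comb scale u v (c, d)) = 0"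
  then have eq: "x * a + y * c = 0" "x * b + y * d = 0"
    using assms(1) by (simp_all add: comb_scale comb_add comb_eq_0_iff)
  have "?D * x = d * (x * a + y * c) - c * (x * b + y * d)"
    "?D * y = a * (x * b + y * d) - b * (x * a + y * c)"
    by (simp_all add: algebra_simps)
  then show "x = 0 \<and> y = 0" using eq assms(2) by simp
next
  let ?D = "a * d - b * c"
  fix w
  obtain p q where w: "w = comb scale u v (p, q)"
    using comb_cases[OF assms(1)] by blast
  \<comment> \<open>Cramer's rule for the coordinates of \<open>w\<close> in the new pair.\<close>
  have "(p * d - q * c) / ?D * a + (a * q - b * p) / ?D * c = p"
    "(p * d - q * c) / ?D * b + (a * q - b * p) / ?D * d = q"
    using assms(2) by (simp_all add: divide_simps) (simp_all add: algebra_simps)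
  then show "\<exists>x y. w = scale x (comb scale u v (a, b)) + scale y (comb scale u v (c, d))"
    unfolding w comb_scale comb_add by metis
qed

lemma basis_pair_swap: "basis_pair scale u v \<Longrightarrow> basis_pair scale v u"
  using basis_pair_change[of u v 0 0 1 1] by (simp add: comb_pair)

end

context nonassoc_algebra
begin

lemma mult_add_left: "mult (x + y) z = mult x z + mult y z"
  and mult_scale_left: "mult (scale c x) z = scale c (mult x z)"
  and mult_add_right: "mult z (x + y) = mult z x + mult z y"
  and mult_scale_right: "mult z (scale c x) = scale c (mult z x)"
  using linear_mult_left[of z] linear_mult_right[of z]
  by (simp_all add: Vector_Spaces.linear_iff)

lemma mult_comb:
  assumes "has_table scale mult u v (a1, a2) (b1, b2) (c1, c2) (d1, d2)"
  shows "mult (comb scale u v (x1, x2)) (comb scale u v (y1, y2)) =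
    comb scale u v
      (x1 * y1 * a1 + x1 * y2 * b1 + x2 * y1 * c1 + x2 * y2 * d1,
       x1 * y1 * a2 + x1 * y2 * b2 + x2 * y1 * c2 + x2 * y2 * d2)"
proof -
  have "mult (comb scale u v (x1, x2)) (comb scale u v (y1, y2)) =
    scale (x1 * y1) (mult u u) + scale (x1 * y2) (mult u v) +
    scale (x2 * y1) (mult v u) + scale (x2 * y2) (mult v v)"
    by (simp add: comb_pair mult_add_left mult_add_right mult_scale_left mult_scale_right
        scale_right_distrib mult.commute mult.left_commute add_ac)
  then show ?thesis
    using assms by (simp add: has_table_def comb_scale comb_add)
qed

lemma has_table_exists:
  assumes "basis_pair scale u v"
  obtains a1 a2 b1 b2 c1 c2 d1 d2
  where "has_table scale mult u v (a1, a2) (b1, b2) (c1, c2) (d1, d2)"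
proof -
  obtain a1 a2 where "mult u u = comb scale u v (a1, a2)" using comb_cases[OF assms] .
  moreover obtain b1 b2 where "mult u v = comb scale u v (b1, b2)" using comb_cases[OF assms] .
  moreover obtain c1 c2 where "mult v u = comb scale u v (c1, c2)" using comb_cases[OF assms] .
  moreover obtain d1 d2 where "mult v v = comb scale u v (d1, d2)" using comb_cases[OF assms] .
  ultimately show thesis using that assms unfolding has_table_def by blast
qed

end

section \<open>Isomorphisms and tables\<close>

text \<open>The isomorphism sends a vector to the one with the same coordinates; by bilinearity the
  table determines all products.\<close>

lemma algebra_iso_table:
  assumes "nonassoc_algebra s P" "has_table s P u v A B C D"
    and "nonassoc_algebra s' Q" "has_table s' Q u' v' A B C D"
  shows "algebra_iso s P s' Q"
proof -
  interpret p: nonassoc_algebra s P by fact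
  interpret q: nonassoc_algebra s' Q by fact
  have b: "basis_pair s u v" "basis_pair s' u' v'"
    using assms by (auto simp: has_table_def)
  define f where "f = comb s' u' v' \<circ> inv (comb s u v)"
  have f: "f (comb s u v x) = comb s' u' v' x" for x
    using b(1) by (simp add: f_def basis_pair_def bij_is_inj)
  have "bij f"
    using b unfolding f_def basis_pair_def by (intro bij_comp bij_imp_bij_inv)
  moreover have "Vector_Spaces.linear s s' f"
    unfolding Vector_Spaces.linear_iff
  proof (intro conjI allI)
    show "vector_space s" "vector_space s'" by unfold_locales
    fix x y c
    obtain x1 x2 where x: "x = comb s u v (x1, x2)" using p.comb_cases[OF b(1)] .
    obtain y1 y2 where y: "y = comb s u v (y1, y2)" using p.comb_cases[OF b(1)] .
    show "f (x + y) = f x + f y" "f (s c x) = s' c (f x)"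
      by (simp_all add: x y f p.comb_add p.comb_scale q.comb_add q.comb_scale)
  qed
  moreover have "f (P x y) = Q (f x) (f y)" for x y
  proof -
    obtain x1 x2 where x: "x = comb s u v (x1, x2)" using p.comb_cases[OF b(1)] .
    obtain y1 y2 where y: "y = comb s u v (y1, y2)" using p.comb_cases[OF b(1)] .
    show ?thesis
      using assms(2,4)
      by (cases A; cases B; cases C; cases D) (simp add: x y f p.mult_comb q.mult_comb)
  qed
  ultimately show ?thesis unfolding algebra_iso_def by blast
qed

lemma has_table_iso:
  assumes "Vector_Spaces.linear s s' f" "bij f" "\<And>x y. f (P x y) = Q (f x) (f y)"
    and "has_table s P u v A B C D"
  shows "has_table s' Q (f u) (f v) A B C D"
proof -
  have f: "f (comb s u v x) = comb s' (f u) (f v) x" for x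
    using assms(1) by (cases x) (simp add: comb_pair Vector_Spaces.linear_iff)
  then have "comb s' (f u) (f v) = f \<circ> comb s u v" by auto
  then have "basis_pair s' (f u) (f v)"
    using assms(2,4) by (simp add: basis_pair_def has_table_def bij_comp)
  then show ?thesis
    using assms(4) by (simp add: has_table_def f flip: assms(3))
qed

section \<open>The normal form, the terminal identity in coordinates and changes of basis\<close>

text \<open>Here \<open>n\<close> spans a two-sided ideal of square zero, on which \<open>e\<close>
  acts by \<alpha> from the left and \<beta> from the right; \<epsilon> is the structure constant of
  the quotient, and \<delta> measures how far \<open>e\<close> is from squaring to \<epsilon>
  \<open>e\<close>.\<close>

abbreviation normal_table :: "('k::field \<Rightarrow> 'v \<Rightarrow> 'v::ab_group_add) \<Rightarrow> ('v \<Rightarrow> 'v \<Rightarrow> 'v) \<Rightarrow> 'v \<Rightarrow> 'v \<Rightarrow>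
    'k \<Rightarrow> 'k \<Rightarrow> 'k \<Rightarrow> 'k \<Rightarrow> bool" where
  "normal_table s P e n \<epsilon> \<alpha> \<beta> \<delta> \<equiv> has_table s P e n (\<epsilon>, \<delta>) (0, \<alpha>) (0, \<beta>) (0, 0)"

context nonassoc_algebra
begin

text \<open>The brackets are built from products, sums and differences, all of which the injective
  coordinate map respects. The identity thus becomes a computation with pairs of scalars, and
  evaluating it at basis vectors yields polynomial equations in the table.\<close>

lemma terminal_coordinates:
  assumes T: "has_table scale mult u v (a1, a2) (b1, b2) (c1, c2) (d1, d2)" and "terminal mult"
  defines "R \<equiv> (\<lambda>(x1, x2) (y1, y2).
      (x1 * y1 * a1 + x1 * y2 * b1 + x2 * y1 * c1 + x2 * y2 * d1,
       x1 * y1 * a2 + x1 * y2 * b2 + x2 * y1 * c2 + x2 * y2 * d2))"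
  shows "bracket22 (bracket12 (bracket20 R t) R) R x y z = (0, 0)"
proof -
  let ?c = "comb scale u v"
  have m: "mult (?c x) (?c y) = ?c (R x y)" for x y
    by (cases x; cases y) (simp add: R_def mult_comb[OF T])
  have a: "?c x + ?c y = ?c (x + y)" for x y
    by (cases x; cases y) (simp add: comb_add)
  have d: "?c x - ?c y = ?c (x - y)" for x y
    by (cases x; cases y) (simp add: comb_diff)
  have "bracket22 (bracket12 (bracket20 mult (?c t)) mult) mult (?c x) (?c y) (?c z) =
      ?c (bracket22 (bracket12 (bracket20 R t) R) R x y z)"
    by (simp add: bracket22_def bracket12_def bracket20_def m a d)
  moreover have "basis_pair scale u v" using T by (simp add: has_table_def)
  ultimately show ?thesis
    using assms(2) by (simp add: terminal_def fun_eq_iff comb_eq_0_iff)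
qed

text \<open>The factors of the first equation give the families: for \<epsilon> = 1 and \<delta> = 0
  they are \<open>T07\<close>, \<open>T08\<close> and \<open>T10\<close>, in this order.\<close>

lemma normal_table_terminal:
  assumes T: "normal_table scale mult e n \<epsilon> \<alpha> \<beta> \<delta>" and "terminal mult"
  shows "\<beta> * (2 * \<alpha> + \<beta> - 3 * \<epsilon>) * (\<alpha> + \<beta> - \<epsilon>) = 0" "\<delta> * \<beta> * (2 * \<alpha> + \<beta> - 3 * \<epsilon>) = 0"
proof -
  note E = terminal_coordinates[OF assms, unfolded bracket22_def bracket12_def bracket20_def]
  show "\<beta> * (2 * \<alpha> + \<beta> - 3 * \<epsilon>) * (\<alpha> + \<beta> - \<epsilon>) = 0"
    using E[of "(0, 1)" "(1, 0)" "(1, 0)" "(1, 0)"] by simp algebra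
  show "\<delta> * \<beta> * (2 * \<alpha> + \<beta> - 3 * \<epsilon>) = 0"
    using E[of "(1, 0)" "(1, 0)" "(1, 0)" "(1, 0)"] by simp algebra
qed

text \<open>These changes of basis keep the line of \<open>n\<close>. Only \<open>p\<close> affects
  \<epsilon>, \<alpha>, \<beta>; the shift \<open>r\<close> and the scale \<open>s\<close> are free
  for adjusting \<delta>.\<close>

lemma normal_table_change:
  assumes T: "normal_table scale mult e n \<epsilon> \<alpha> \<beta> \<delta>" and "p \<noteq> 0" "s \<noteq> 0"
  shows "normal_table scale mult (comb scale e n (p, r)) (comb scale e n (0, s))
    (p * \<epsilon>) (p * \<alpha>) (p * \<beta>) ((p\<^sup>2 * \<delta> + p * r * (\<alpha> + \<beta> - \<epsilon>)) / s)"
proof -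
  have b: "basis_pair scale e n" using T by (simp add: has_table_def)
  show ?thesis
    unfolding has_table_def mult_comb[OF T] comb_comb
    using assms(2,3) by (simp add: basis_pair_change[OF b] comb_eq_iff[OF b])
      (simp add: algebra_simps power2_eq_square)
qed

text \<open>Left multiplication by \<open>u\<close> is triangular with eigenvalues \<open>l\<close>
  and \<open>b\<close>. If they differ it is diagonalizable, and \<open>v + t u\<close> is an
  eigenvector for \<open>b\<close> exactly when \<open>t (b - l) = a\<close>.\<close>

lemma table_shift:
  assumes T: "has_table scale mult u v (l, 0) (a, b) (c, d) (p, q)" and "b \<noteq> l"
  shows "\<exists>w c d p q. has_table scale mult u w (l, 0) (0, b) (c, d) (p, q)"
proof -
  have b: "basis_pair scale u v" using T by (simp add: has_table_def)
  define t where "t = a / (b - l)"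
  have t: "t * (b - l) = a" using assms(2) by (simp add: t_def)
  let ?w = "comb scale u v (t, 1)"
  have u: "comb scale u v (1, 0) = u" by (simp add: comb_pair)
  have b': "basis_pair scale u ?w" using basis_pair_change[OF b, of 1 1 0 t] by (simp add: u)
  then obtain a' b' c' d' p' q' l' m' where 
    T': "has_table scale mult u ?w (l', m') (a', b') (c', d') (p', q')"
    using has_table_exists by blast
  have "mult u u = comb scale u ?w (l, 0)"
    using T by (simp add: has_table_def comb_pair)
  moreover have "mult u ?w = comb scale u ?w (0, b)"
    using mult_comb[OF T, of 1 0 t 1] comb_comb[of u v 1 0 t 1 0 b] t
    by (simp add: u algebra_simps)
  ultimately have "has_table scale mult u ?w (l, 0) (0, b) (c', d') (p', q')"
    using T' by (simp add: has_table_def)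
  then show ?thesis by blast
qed

end

section \<open>Solving the equations for a table with an idempotent\<close>

text \<open>For the table \<open>u u = u\<close>, \<open>u v = b v\<close>,
  \<open>v u = c u + d v\<close>, \<open>v v = p u + q v\<close>, the four outcomes are: already
  normal; normal after replacing \<open>v\<close> by \<open>v - c u\<close>; \<open>u\<close> is a
  two-sided unit; \<open>u\<close> and a multiple of \<open>v\<close> are orthogonal
  idempotents.\<close>

lemma idempotent_parameters:
  fixes b c d p q :: "'k::field_char_0"
  assumes "d * (2 * b + d - 3) * (b + d - 1) = 0"
    and "b * (b - 1) * c = 0" "b * (b - 1) * q = 0" "p * (2 * b - 1) * (b - 1) = 0"
    and "c * (b - 1) * (1 - d) = 0" "c * d * (b + d - 1) = 0"
    and "b * c\<^sup>2 - b * c * q + 2 * b * d * p + c * d * q - 2 * b * p - d * p + p = 0"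
    and "2 * b * d * p - c\<^sup>2 * d - c\<^sup>2 + c * q - 3 * d * p + p = 0"
    and "p * p * (4 * b - d - 3) = 0"
    and "- 2 * b\<^sup>2 * p + b * c * q - b * d * p - b * q\<^sup>2 + d * q\<^sup>2 + b * p + 2 * d * p = 0"
    and "d * p * (3 - d - 2 * b) = 0"
    and "- 3 * b * c * d + 2 * b * d * q - c * d\<^sup>2 + 3 * c * d - 2 * d * q = 0"
  obtains "c = 0" "p = 0" "q = 0" | "b = 1" "d = 0" "p = 0" "q = c" | "b = 1" "d = 1" "c = 0"
    | "b = 0" "d = 0" "c = 0" "p = 0" "q \<noteq> 0"
proof -
  have "c = 0 \<and> p = 0 \<and> q = 0 \<or> b = 1 \<and> d = 0 \<and> p = 0 \<and> q = c \<or> b = 1 \<and> d = 1 \<and> c = 0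
    \<or> b = 0 \<and> d = 0 \<and> c = 0 \<and> p = 0 \<and> q \<noteq> 0"
  proof (cases "b = 1")
    case True
    have "d = 0 \<or> d = 1" using assms(1) True by auto
    then show ?thesis
    proof
      assume "d = 0"
      with True assms(9) have "p = 0" by auto
      \<comment> \<open>The two equations reduce to \<open>c (q - c) = 0\<close> and
        \<open>q (c - q) = 0\<close>.\<close>
      moreover have "(q - c)\<^sup>2 = 0"
        using assms(8,10) True \<open>d = 0\<close> \<open>p = 0\<close> by simp algebra
      ultimately show ?thesis using True \<open>d = 0\<close> by simp
    next
      assume "d = 1"
      then show ?thesis using True assms(6) by simp
    qed
  next
    case b: False
    show ?thesis
    proof (cases "c = 0")
      case c: True
      have pb: "p = 0 \<or> b = 1 / 2"
        using b assms(4) by (simp add: eq_divide_eq) (auto simp: algebra_simps)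
      have "p = 0"
      proof (rule ccontr)
        assume p: "p \<noteq> 0"
        with pb have "b = 1 / 2" by simp
        have "4 * b - d - 3 = 0" using p assms(9) by simp
        with \<open>b = 1 / 2\<close> have "d = -1" by algebra
        with p \<open>b = 1 / 2\<close> assms(11) show False by simp
      qed
      \<comment> \<open>What remains is \<open>b q = 0\<close> and \<open>d q = 0\<close>: either
        \<open>q\<close> vanishes, or \<open>b\<close> and \<open>d\<close> both do.\<close>
      then show ?thesis using b c assms(3,12) by auto
    next
      \<comment> \<open>This case is contradictory: the equations force \<open>b = 0\<close>,
        \<open>d = 1\<close>, \<open>p = q = 0\<close> and then
        \<open>- 2 c\<^sup>2 = 0\<close>.\<close>
      case c: False
      with b assms(2,5) have "b = 0" "d = 1" by auto
      with assms(4) have "p = 0" by simp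
      with c assms(7) \<open>b = 0\<close> \<open>d = 1\<close> have "q = 0" by simp
      with c assms(8) \<open>b = 0\<close> \<open>d = 1\<close> \<open>p = 0\<close> have False by simp
      then show ?thesis ..
    qed
  qed
  then show thesis using that by blast
qed

text \<open>The product of two copies of the base field, with its two orthogonal idempotents as
  basis.\<close>

abbreviation idempotent_table :: "('k::field \<Rightarrow> 'v \<Rightarrow> 'v::ab_group_add) \<Rightarrow> ('v \<Rightarrow> 'v \<Rightarrow> 'v) \<Rightarrow>
    'v \<Rightarrow> 'v \<Rightarrow> bool" where
  "idempotent_table s P e f \<equiv> has_table s P e f (1, 0) (0, 0) (0, 0) (0, 1)"

lemma (in nonassoc_algebra) table_rescale:
  assumes T: "has_table scale mult u v (l, 0) (a, b) (c, d) (p, q)" and "l \<noteq> 0"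
  shows "\<exists>w a b c d p q. has_table scale mult w v (1, 0) (a, b) (c, d) (p, q)"
proof -
  have b: "basis_pair scale u v" using T by (simp add: has_table_def)
  let ?w = "comb scale u v (1 / l, 0)"
  have "comb scale u v (0, 1) = v" by (simp add: comb_pair)
  then have b': "basis_pair scale ?w v"
    using basis_pair_change[OF b, of "1 / l" 1 0 0] assms(2) by simp
  moreover have "mult ?w ?w = comb scale ?w v (1, 0)"
    unfolding mult_comb[OF T] using assms(2) by (simp add: comb_pair)
  ultimately show ?thesis
    using has_table_exists[OF b'] unfolding has_table_def by metis
qed

section \<open>Vectors parallel to their squares\<close>

lemma quadratic_root:
  fixes b c :: "'k::alg_closed_field"
  obtains x where "x * x = b * x + c"
proof -
  have "\<exists>x. poly [:- c, - b, 1:] x = 0"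
    by (intro alg_closed_imp_poly_has_root) simp
  then obtain x where "- c + x * (- b + x) = 0" by auto
  then have "x * x = b * x + c" by algebra
  then show thesis ..
qed

lemma cubic_root:
  fixes a b c d :: "'k::alg_closed_field"
  assumes "d \<noteq> 0"
  obtains x where "a + b * x + c * x\<^sup>2 + d * x ^ 3 = 0"
proof -
  have "\<exists>x. poly [:a, b, c, d:] x = 0"
    using assms by (intro alg_closed_imp_poly_has_root) simp
  then obtain x where "a + x * (b + x * (c + x * d)) = 0" by auto
  then have "a + b * x + c * x\<^sup>2 + d * x ^ 3 = 0" by algebra
  then show thesis ..
qed

text \<open>The vectors \<open>x\<close> for which \<open>x\<close> and \<open>x x\<close> are dependent are the zeros of a binary cubic form.\<close>

lemma square_parallel_exists:
  fixes scale :: "'k::alg_closed_field \<Rightarrow> 'v::ab_group_add \<Rightarrow> 'v"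
  assumes "nonassoc_algebra scale P" "vector_space.dim scale UNIV = 2"
  obtains u v l a b c d p q where "has_table scale P u v (l, 0) (a, b) (c, d) (p, q)"
proof -
  interpret nonassoc_algebra scale P by fact
  obtain u v where b: "basis_pair scale u v"
    using basis_pair_exists[OF assms(2)] .
  obtain a1 a2 b1 b2 c1 c2 d1 d2 where
    T: "has_table scale P u v (a1, a2) (b1, b2) (c1, c2) (d1, d2)"
    using has_table_exists[OF b] .
  have "\<exists>x y l. basis_pair scale x y \<and> P x x = comb scale x y (l, 0)"
  proof (cases "d1 = 0")
    case True
    then have "P v v = comb scale v u (d2, 0)"
      using T by (simp add: has_table_def comb_pair)
    then show ?thesis using basis_pair_swap[OF b] by blast
  next
    case False
    then obtain t where
      t: "a2 + (b2 + c2 - a1) * t + (d2 - b1 - c1) * t\<^sup>2 + (- d1) * t ^ 3 = 0"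
      using cubic_root[of "- d1"] by (metis neg_equal_0_iff_equal)
    let ?x = "comb scale u v (1, t)"
    have v: "comb scale u v (0, 1) = v" by (simp add: comb_pair)
    have "basis_pair scale ?x v"
      using basis_pair_change[OF b, of 1 1 t 0] by (simp add: v)
    moreover have "P ?x ?x = comb scale ?x v (a1 + t * (b1 + c1) + t * t * d1, 0)"
    proof -
      have "a2 + t * b2 + t * c2 + t * t * d2 = (a1 + t * (b1 + c1) + t * t * d1) * t"
        using t by algebra
      then show ?thesis
        unfolding mult_comb[OF T]
        using comb_comb[of u v 1 t 0 1 "a1 + t * (b1 + c1) + t * t * d1" 0]
        by (simp add: v algebra_simps)
    qed
    ultimately show ?thesis by blast
  qed
  then obtain x y l where b: "basis_pair scale x y" and x: "P x x = comb scale x y (l, 0)"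
    by blast
  show thesis
    using has_table_exists[OF b] x that unfolding has_table_def by metis
qed

context nonassoc_algebra
begin

lemma idempotent_equations:
  assumes T: "has_table scale mult u v (1, 0) (0, b) (c, d) (p, q)" and "terminal mult"
  shows "d * (2 * b + d - 3) * (b + d - 1) = 0"
    and "b * (b - 1) * c = 0" and "b * (b - 1) * q = 0" and "2 * (p * (2 * b - 1) * (b - 1)) = 0"
    and "c * (b - 1) * (1 - d) = 0" and "c * d * (b + d - 1) = 0"
    and "b * c\<^sup>2 - b * c * q + 2 * b * d * p + c * d * q - 2 * b * p - d * p + p = 0"
    and "2 * b * d * p - c\<^sup>2 * d - c\<^sup>2 + c * q - 3 * d * p + p = 0"
    and "p * p * (4 * b - d - 3) = 0"
    and "- 2 * b\<^sup>2 * p + b * c * q - b * d * p - b * q\<^sup>2 + d * q\<^sup>2 + b * p + 2 * d * p = 0"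
    and "d * p * (3 - d - 2 * b) = 0"
    and "- 3 * b * c * d + 2 * b * d * q - c * d\<^sup>2 + 3 * c * d - 2 * d * q = 0"
proof -
  note E = terminal_coordinates[OF assms, unfolded bracket22_def bracket12_def bracket20_def]
  let ?e = "(1, 0)" and ?f = "(0, 1)"
  show "d * (2 * b + d - 3) * (b + d - 1) = 0" using E[of ?f ?e ?e ?e] by simp algebra
  show "b * (b - 1) * c = 0" using E[of ?e ?e ?f ?e] by simp algebra
  show "b * (b - 1) * q = 0" using E[of ?e ?e ?f ?f] by simp algebra
  show "2 * (p * (2 * b - 1) * (b - 1)) = 0" using E[of ?e ?e ?f ?f] by simp algebra
  show "c * (b - 1) * (1 - d) = 0" using E[of ?e ?f ?e ?e] by simp algebra
  show "c * d * (b + d - 1) = 0" using E[of ?f ?e ?e ?e] by simp algebra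
  show "b * c\<^sup>2 - b * c * q + 2 * b * d * p + c * d * q - 2 * b * p - d * p + p = 0"
    using E[of ?f ?e ?f ?e] by simp algebra
  show "2 * b * d * p - c\<^sup>2 * d - c\<^sup>2 + c * q - 3 * d * p + p = 0"
    using E[of ?f ?f ?e ?e] by simp algebra
  show "p * p * (4 * b - d - 3) = 0" using E[of ?f ?f ?f ?f] by simp algebra
  show "- 2 * b\<^sup>2 * p + b * c * q - b * d * p - b * q\<^sup>2 + d * q\<^sup>2 + b * p + 2 * d * p = 0"
    using E[of ?f ?e ?f ?f] by simp algebra
  show "d * p * (3 - d - 2 * b) = 0" using E[of ?f ?f ?f ?e] by simp algebra
  show "- 3 * b * c * d + 2 * b * d * q - c * d\<^sup>2 + 3 * c * d - 2 * d * q = 0"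
    using E[of ?f ?f ?e ?e] by simp algebra
qed

lemma idempotent_unit_equations:
  assumes T: "has_table scale mult u v (1, 0) (a, 1) (c, d) (p, q)" and "terminal mult"
  shows "2 * a = 0"
proof -
  note E = terminal_coordinates[OF assms, unfolded bracket22_def bracket12_def bracket20_def]
  let ?e = "(1, 0)" and ?f = "(0, 1)"
  have "a * d - a = 0" using E[of ?e ?e ?f ?e] by simp
  moreover have "- a * d - a = 0" using E[of ?e ?e ?f ?f] by simp
  ultimately show ?thesis by algebra
qed

lemma square_zero_equations:
  assumes T: "has_table scale mult u v (0, 0) (0, b) (c, d) (p, q)" and "terminal mult"
  shows "b * b * c = 0" and "2 * (b * b * q) = 0" and "4 * (b * b * p) = 0"
proof -
  note E = terminal_coordinates[OF assms, unfolded bracket22_def bracket12_def bracket20_def]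
  let ?e = "(1, 0)" and ?f = "(0, 1)"
  show "b * b * c = 0" using E[of ?e ?e ?f ?e] by (simp add: zero_prod_def)
  show "2 * (b * b * q) = 0" using E[of ?e ?e ?f ?f] by (simp add: zero_prod_def)
  show "4 * (b * b * p) = 0" using E[of ?e ?e ?f ?f] by (simp add: zero_prod_def)
qed

lemma square_zero_nilpotent_equations:
  assumes T: "has_table scale mult u v (0, 0) (a, 0) (c, d) (p, q)" and "terminal mult"
  shows "d * d * d = 0"
  using terminal_coordinates[OF assms, unfolded bracket22_def bracket12_def bracket20_def,
      of "(0, 1)" "(1, 0)" "(1, 0)" "(1, 0)"] by simp

end

lemma idempotent_table_if_split:
  assumes "nonassoc_algebra s P" and T: "has_table s P u v (1, 0) (0, 1) (0, 1) (- (r * r'), r + r')"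
    and "r \<noteq> r'"
  shows "\<exists>e f. idempotent_table s P e f"
proof -
  interpret nonassoc_algebra s P by fact
  have b: "basis_pair s u v" using T by (simp add: has_table_def)
  define h where "h = 1 / (r' - r)"
  have h: "h * r' = 1 + h * r" using assms(3) by (simp add: h_def field_simps)
  let ?f = "comb s u v (- h * r, h)" and ?e = "comb s u v (1 + h * r, - h)"
  have "h \<noteq> 0" using assms(3) by (simp add: h_def)
  have "has_table s P ?e ?f (1, 0) (0, 0) (0, 0) (0, 1)"
    unfolding has_table_def mult_comb[OF T] comb_comb comb_eq_iff[OF b] prod.inject
  proof (intro conjI basis_pair_change[OF b])
    show "(1 + h * r) * h - - h * (- h * r) \<noteq> 0"
      using \<open>h \<noteq> 0\<close> by (simp add: algebra_simps)
  qed (use h in algebra)+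
  then show ?thesis by blast
qed

lemma normal_or_idempotent_table:
  fixes scale :: "'k::{alg_closed_field, field_char_0} \<Rightarrow> 'v::ab_group_add \<Rightarrow> 'v"
  assumes "nonassoc_algebra scale P" "vector_space.dim scale UNIV = 2" "terminal P"
  shows "(\<exists>e n \<epsilon> \<alpha> \<beta> \<delta>. normal_table scale P e n \<epsilon> \<alpha> \<beta> \<delta>) \<or> (\<exists>e f. idempotent_table scale P e f)"
proof -
  interpret nonassoc_algebra scale P by fact
  obtain u v l a b c d p q where T: "has_table scale P u v (l, 0) (a, b) (c, d) (p, q)"
    using square_parallel_exists[OF assms(1,2)] .
  show ?thesis
  proof (cases "l = 0")
    case l: True
    show ?thesis
    proof (cases "b = 0")
      case True
      then have "d = 0"
        using square_zero_nilpotent_equations[of u v a c d p q] T assms(3) l by simp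
      then have "normal_table scale P v u q c a p"
        using T True l basis_pair_swap by (auto simp: has_table_def comb_pair)
      then show ?thesis by blast
    next
      case False
      with l obtain w c d p q where T': "has_table scale P u w (0, 0) (0, b) (c, d) (p, q)"
        using table_shift[OF T] by auto
      from square_zero_equations[OF T' assms(3)] False have "c = 0" "p = 0" "q = 0"
        by simp_all
      then show ?thesis using T' by blast
    qed
  next
    case False
    then obtain u v a b c d p q where T: "has_table scale P u v (1, 0) (a, b) (c, d) (p, q)"
      using table_rescale[OF T] by blast
    have "\<exists>v b c d p q. has_table scale P u v (1, 0) (0, b) (c, d) (p, q)"
    proof (cases "b = 1")
      case True
      then have "a = 0" using idempotent_unit_equations[of u v a c d p q] T assms(3) by simp
      then show ?thesis using T by blast
    next
      case False
      then show ?thesis using table_shift[OF T] by blast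
    qed
    then obtain v b c d p q where T: "has_table scale P u v (1, 0) (0, b) (c, d) (p, q)" by blast
    have bp: "basis_pair scale u v" using T by (simp add: has_table_def)
    note E = idempotent_equations[OF T assms(3)]
    have "p * (2 * b - 1) * (b - 1) = 0" using E(4) by simp
    from E(1-3) this E(5-12) show ?thesis
    proof (cases rule: idempotent_parameters)
      case 1
      then show ?thesis using T by blast
    next
      case 2
      have "normal_table scale P (comb scale u v (1, 0)) (comb scale u v (- c, 1)) 1 1 0 0"
        unfolding has_table_def mult_comb[OF T] comb_comb comb_eq_iff[OF bp] prod.inject
        using 2 by (simp add: basis_pair_change[OF bp])
      then show ?thesis by blast
    next
      case 3
      obtain r where r: "r * r = q * r + p"
        using quadratic_root by blast
      show ?thesis
      proof (cases "r = q - r")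
        case True
        then have q: "q = r + r" by algebra
        have "normal_table scale P (comb scale u v (1, 0)) (comb scale u v (- r, 1)) 1 1 1 0"
          unfolding has_table_def mult_comb[OF T] comb_comb comb_eq_iff[OF bp] prod.inject
          using 3 r by (simp add: basis_pair_change[OF bp] q)
        then show ?thesis by blast
      next
        case False
        have "p = - (r * (q - r))" "q = r + (q - r)"
          using r by (simp_all add: algebra_simps)
        then show ?thesis
          using idempotent_table_if_split[OF assms(1), of u v r "q - r"] T 3 False by metis
      qed
    next
      case 4
      have "idempotent_table scale P (comb scale u v (1, 0)) (comb scale u v (0, 1 / q))"
        unfolding has_table_def mult_comb[OF T] comb_comb comb_eq_iff[OF bp] prod.inject
        using 4 by (simp add: basis_pair_change[OF bp])
      then show ?thesis by blast
    qed
  qed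
qed

text \<open>The normal-form parameters \<open>(\<epsilon>, \<alpha>, \<beta>, \<delta>)\<close>; the value at \<open>T09\<close> is junk.\<close>

fun params :: "'k::field terminal_name \<Rightarrow> 'k \<times> 'k \<times> 'k \<times> 'k" where
  "params T01 = (1, 1, 0, 1)"
| "params T02 = (1, 2, - 1, 1)"
| "params T03 = (0, 0, 0, 1)"
| "params T04 = (0, 1, 0, 0)"
| "params T05 = (0, - 1, 2, 0)"
| "params T06 = (0, 1, - 1, 0)"
| "params (T07 \<alpha>) = (1, \<alpha>, 0, 0)"
| "params (T08 \<alpha>) = (1, \<alpha>, 3 - 2 * \<alpha>, 0)"
| "params T09 = (0, 0, 0, 0)"
| "params (T10 \<alpha>) = (1, \<alpha>, 1 - \<alpha>, 0)"

definition normalizable :: "('k::field \<Rightarrow> 'v \<Rightarrow> 'v::ab_group_add) \<Rightarrow> ('v \<Rightarrow> 'v \<Rightarrow> 'v) \<Rightarrow>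
    'k \<times> 'k \<times> 'k \<times> 'k \<Rightarrow> bool" where
  "normalizable s P = (\<lambda>(\<epsilon>, \<alpha>, \<beta>, \<delta>). \<exists>e n. normal_table s P e n \<epsilon> \<alpha> \<beta> \<delta>)"

lemma nonassoc_algebra_terminal_mult: "nonassoc_algebra (*s) (terminal_mult t)"
  by (cases t) (simp_all add: nonassoc_algebra_structure_mult)

lemma axis_nth_2:
  "(axis 1 x :: 'k::zero ^ 2) $ 1 = x" "(axis 1 x :: 'k::zero ^ 2) $ 2 = 0"
  "(axis 2 x :: 'k::zero ^ 2) $ 1 = 0" "(axis 2 x :: 'k::zero ^ 2) $ 2 = x"
  by (simp_all add: axis_def)

lemma basis_pair_axis: "basis_pair (*s) (e1 :: 'k::field ^ 2) e2"
proof (rule vec.basis_pairI)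
  show "\<exists>a b. x = a *s e1 + b *s e2" for x :: "'k ^ 2"
    by (rule exI[of _ "x $ 1"], rule exI[of _ "x $ 2"]) (simp add: vec_eq_iff forall_2 axis_nth_2)
qed (auto simp: vec_eq_iff forall_2 axis_nth_2)

lemma normalizable_terminal_mult:
  fixes t :: "'k::field terminal_name"
  assumes "t \<noteq> T09"
  shows "normalizable (*s) (terminal_mult t) (params t)"
proof -
  have b: "basis_pair (*s) (e1 :: 'k ^ 2) e2" "basis_pair (*s) (e2 :: 'k ^ 2) e1"
    "basis_pair (*s) (e1 :: 'k ^ 2) (e2 - e1)"
    using basis_pair_axis vec.basis_pair_swap[OF basis_pair_axis]
      vec.basis_pair_change[OF basis_pair_axis, of 1 1 0 "- 1"]
    by (simp_all add: comb_pair)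
  define N where "N e n = (case params t of (\<epsilon>, \<alpha>, \<beta>, \<delta>) \<Rightarrow>
    normal_table (*s) (terminal_mult t) e n \<epsilon> \<alpha> \<beta> \<delta>)" for e n
  have "N e1 e2 \<or> N e2 e1 \<or> N e1 (e2 - e1)"
    using assms
    by (cases t) (simp_all add: N_def has_table_def b comb_pair structure_mult_def vec_eq_iff
        forall_2 axis_nth_2 algebra_simps)
  then show ?thesis
    by (auto simp: N_def normalizable_def split: prod.splits)
qed

lemma idempotent_table_terminal_mult: "idempotent_table (*s) (terminal_mult T09) e1 e2"
  by (simp add: has_table_def basis_pair_axis comb_pair structure_mult_def vec_eq_iff
      forall_2 axis_nth_2)

lemma normalizable_iso_terminal_mult:
  assumes "nonassoc_algebra s P" "normalizable s P (params t)" "t \<noteq> T09"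
  shows "algebra_iso s P (*s) (terminal_mult t)"
  using assms(2) normalizable_terminal_mult[OF assms(3)]
    algebra_iso_table[OF assms(1) _ nonassoc_algebra_terminal_mult]
  by (fastforce simp: normalizable_def split: prod.splits)

lemma normalizable_terminal:
  fixes P :: "'v::ab_group_add \<Rightarrow> 'v \<Rightarrow> 'v" and s :: "'k::field_char_0 \<Rightarrow> 'v \<Rightarrow> 'v"
  assumes "nonassoc_algebra s P" and T: "normal_table s P e n \<epsilon> \<alpha> \<beta> \<delta>"
    and "terminal P" "P \<noteq> (\<lambda>x y. 0)"
  shows "\<exists>t. admissible t \<and> t \<noteq> T09 \<and> normalizable s P (params t)"
proof -
  interpret nonassoc_algebra s P by fact
  note E = normal_table_terminal[OF T assms(3)]
  have change: "normalizable s P (p * \<epsilon>, p * \<alpha>, p * \<beta>, (p\<^sup>2 * \<delta> + p * r * (\<alpha> + \<beta> - \<epsilon>)) / q)"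
    if "p \<noteq> 0" "q \<noteq> 0" for p q r
    using normal_table_change[OF T that] by (auto simp: normalizable_def)
  have eliminate: "normalizable s P (p * \<epsilon>, p * \<alpha>, p * \<beta>, 0)"
    if "p \<noteq> 0" "\<alpha> + \<beta> \<noteq> \<epsilon> \<or> \<delta> = 0" for p
  proof (cases "\<delta> = 0")
    case True
    then show ?thesis using change[of p 1 0] that by simp
  next
    case False
    then have "\<alpha> + \<beta> - \<epsilon> \<noteq> 0" using that by simp
    then show ?thesis
      using change[of p 1 "- p * \<delta> / (\<alpha> + \<beta> - \<epsilon>)"] that
      by (simp add: power2_eq_square)
  qed
  show ?thesis
  proof (cases "\<epsilon> = 0")
    case \<epsilon>: False
    define a b where "a = \<alpha> / \<epsilon>" and "b = \<beta> / \<epsilon>"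
    have ab: "\<alpha> = a * \<epsilon>" "\<beta> = b * \<epsilon>" using \<epsilon> by (simp_all add: a_def b_def)
    have "b * (2 * a + b - 3) * (a + b - 1) * (\<epsilon> * \<epsilon> * \<epsilon>) = 0"
      using E(1) unfolding ab by algebra
    then have "b = 0 \<or> 2 * a + b - 3 = 0 \<or> a + b - 1 = 0" using \<epsilon> by simp
    then have ab_cases: "b = 0 \<or> b = 3 - 2 * a \<or> b = 1 - a" by (auto simp: algebra_simps)
    show ?thesis
    proof (cases "\<alpha> + \<beta> \<noteq> \<epsilon> \<or> \<delta> = 0")
      case True
      have N: "normalizable s P (1, a, b, 0)"
        using eliminate[of "1 / \<epsilon>"] True \<epsilon> by (simp add: a_def b_def)
      have "\<exists>t. admissible t \<and> t \<noteq> T09 \<and> params t = (1, a, b, 0)"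
      proof -
        consider "b = 1 - a" | "b \<noteq> 1 - a" "b = 0" | "b \<noteq> 1 - a" "b \<noteq> 0" "b = 3 - 2 * a"
          using ab_cases by blast
        then show ?thesis
        proof cases
          case 1
          then show ?thesis by (intro exI[of _ "T10 a"]) simp
        next
          case 2
          then show ?thesis by (intro exI[of _ "T07 a"]) auto
        next
          case 3
          then have "a \<noteq> 2" "2 * a \<noteq> 3" by auto
          then have "a \<noteq> 3 / 2" by (auto simp: eq_divide_eq mult.commute)
          with 3 \<open>a \<noteq> 2\<close> show ?thesis by (intro exI[of _ "T08 a"]) simp
        qed
      qed
      with N show ?thesis by metis
    next
      case False
      then have \<delta>: "\<delta> \<noteq> 0" and "(a + b - 1) * \<epsilon> = 0" by (auto simp: ab algebra_simps)
      then have "a + b - 1 = 0" using \<epsilon> by simp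
      then have b: "b = 1 - a" by (simp add: algebra_simps)
      have "b * (2 * a + b - 3) * (\<delta> * \<epsilon> * \<epsilon>) = 0"
        using E(2) unfolding ab by algebra
      then have "b = 0 \<or> 2 * a + b - 3 = 0" using \<epsilon> \<delta> by simp
      then have "a = 1 \<and> b = 0 \<or> a = 2 \<and> b = - 1" unfolding b by (auto simp: algebra_simps)
      moreover have "normalizable s P (1, a, b, 1)"
        using change[of "1 / \<epsilon>" "\<delta> / \<epsilon>\<^sup>2" 0] \<epsilon> \<delta> by (simp add: a_def b_def power2_eq_square)
      ultimately have "normalizable s P (params T01) \<or> normalizable s P (params T02)" by auto
      then show ?thesis by (metis admissible.simps(3,4) terminal_name.distinct)
    qed
  next
    case \<epsilon>: True
    show ?thesis
    proof (cases "\<alpha> = 0 \<and> \<beta> = 0")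
      case True
      have "\<delta> \<noteq> 0"
      proof
        assume "\<delta> = 0"
        have b: "basis_pair s e n" using T by (simp add: has_table_def)
        have "P x y = 0" for x y
        proof -
          obtain x1 x2 y1 y2 where "x = comb s e n (x1, x2)" "y = comb s e n (y1, y2)"
            using comb_cases[OF b] by metis
          then show ?thesis
            using True \<epsilon> \<open>\<delta> = 0\<close> by (simp add: mult_comb[OF T] comb_0)
        qed
        with assms(4) show False by blast
      qed
      then have "normalizable s P (params T03)"
        using change[of 1 \<delta> 0] True \<epsilon> by simp
      then show ?thesis by (intro exI[of _ T03]) simp
    next
      case nz: False
      have "\<beta> = 0 \<or> 2 * \<alpha> + \<beta> = 0 \<or> \<alpha> + \<beta> = 0" using E(1) \<epsilon> by simp
      then have "\<beta> = 0 \<or> \<beta> = - 2 * \<alpha> \<or> \<beta> = - \<alpha>"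
        by (auto simp: eq_neg_iff_add_eq_0 add.commute)
      then consider "\<alpha> \<noteq> 0" "\<beta> = 0" | "\<alpha> \<noteq> 0" "\<beta> = - 2 * \<alpha>" | "\<alpha> \<noteq> 0" "\<beta> = - \<alpha>"
        using nz by (cases "\<alpha> = 0") auto
      then show ?thesis
      proof cases
        case 1
        then have "normalizable s P (params T04)"
          using eliminate[of "1 / \<alpha>"] \<epsilon> by simp
        then show ?thesis by (intro exI[of _ T04]) simp
      next
        case 2
        then have "normalizable s P (params T05)"
          using eliminate[of "- 1 / \<alpha>"] \<epsilon> by simp
        then show ?thesis by (intro exI[of _ T05]) simp
      next
        case 3
        then have "\<delta> = 0" using E(2) \<epsilon> by simp
        with 3 have "normalizable s P (params T06)"
          using eliminate[of "1 / \<alpha>"] \<epsilon> by simp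
        then show ?thesis by (intro exI[of _ T06]) simp
      qed
    qed
  qed
qed

lemma normal_table_unique:
  assumes "nonassoc_algebra s P" and T: "normal_table s P e n \<epsilon> \<alpha> \<beta> \<delta>"
    and T': "normal_table s P e' n' \<epsilon>' \<alpha>' \<beta>' \<delta>'"
    and nz: "(\<epsilon>, \<alpha>, \<beta>, \<delta>) \<noteq> (0, 0, 0, 0)"
  shows "\<exists>p q r. p \<noteq> 0 \<and> q \<noteq> 0 \<and> \<epsilon>' = p * \<epsilon> \<and> \<alpha>' = p * \<alpha> \<and> \<beta>' = p * \<beta> \<and>
    \<delta>' * q = p\<^sup>2 * \<delta> + p * r * (\<alpha> + \<beta> - \<epsilon>)"
proof -
  interpret nonassoc_algebra s P by fact
  have b: "basis_pair s e n" and b': "basis_pair s e' n'"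
    using T T' by (simp_all add: has_table_def)
  obtain p r where e': "e' = comb s e n (p, r)" using comb_cases[OF b] .
  obtain q t where n': "n' = comb s e n (q, t)" using comb_cases[OF b] .
  have det: "q \<noteq> 0 \<or> p \<noteq> 0 \<and> t \<noteq> 0"
  proof (rule ccontr)
    assume "\<not> ?thesis"
    then have "comb s e' n' (t, - r) = 0 \<and> comb s e' n' (0, 1) = comb s e n (0, t)
        \<and> comb s e' n' (1, 0) = comb s e n (p, r) \<and> q = 0 \<and> (p = 0 \<or> t = 0)"
      by (auto simp: e' n' comb_comb comb_0)
    then show False
      by (auto simp: comb_eq_0_iff[OF b'] comb_0)
  qed
  have "P e' e' = comb s e' n' (\<epsilon>', \<delta>')" "P e' n' = comb s e' n' (0, \<alpha>')"
    "P n' e' = comb s e' n' (0, \<beta>')" "P n' n' = comb s e' n' (0, 0)"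
    using T' by (simp_all add: has_table_def)
  then have E: "p * p * \<epsilon> = \<epsilon>' * p + \<delta>' * q"
    "p * p * \<delta> + p * r * \<alpha> + r * p * \<beta> = \<epsilon>' * r + \<delta>' * t"
    "p * q * \<epsilon> = \<alpha>' * q" "p * q * \<delta> + p * t * \<alpha> + r * q * \<beta> = \<alpha>' * t"
    "q * p * \<epsilon> = \<beta>' * q" "q * p * \<delta> + q * r * \<alpha> + t * p * \<beta> = \<beta>' * t"
    "q * q * \<epsilon> = 0" "q * q * \<delta> + q * t * \<alpha> + t * q * \<beta> = 0"
    unfolding e' n' mult_comb[OF T] comb_comb comb_eq_iff[OF b] by simp_all
  show ?thesis
  proof (cases "q = 0")
    case True
    with det have pt: "p \<noteq> 0" "t \<noteq> 0" by auto
    then have "\<epsilon>' = p * \<epsilon>" "\<alpha>' = p * \<alpha>" "\<beta>' = p * \<beta>" using E True by simp_all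
    moreover from this have "\<delta>' * t = p\<^sup>2 * \<delta> + p * r * (\<alpha> + \<beta> - \<epsilon>)"
      using E(2) by (simp add: algebra_simps power2_eq_square)
    ultimately show ?thesis using pt by blast
  next
    case q: False
    then have 0: "\<epsilon> = 0" "\<alpha>' = 0" "\<beta>' = 0" using E(3,5,7) by auto
    have det: "p * t - r * q \<noteq> 0"
    proof
      assume "p * t - r * q = 0"
      then have "comb s e' n' (q, - p) = 0"
        by (simp add: e' n' comb_comb algebra_simps comb_0)
      then show False using q by (simp add: comb_eq_0_iff[OF b'])
    qed
    have "(p * t - r * q) * (\<alpha> - \<beta>) = 0" using E(4,6) 0 by algebra
    then have \<alpha>: "\<alpha> = \<beta>" using det by simp
    have "q * (q * \<delta> + 2 * t * \<beta>) = 0" using E(8) \<alpha> by algebra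
    then have \<delta>: "q * \<delta> + 2 * t * \<beta> = 0" using q by simp
    have "(p * t - r * q) * \<beta> = 0" using E(4) \<delta> \<alpha> 0 by algebra
    then have "\<beta> = 0" using det by simp
    with \<delta> \<alpha> q 0 nz show ?thesis by simp
  qed
qed

lemma normalizable_not_idempotent_table:
  assumes "nonassoc_algebra s P" "normalizable s P x"
    and T: "idempotent_table s P f g"
  shows False
proof -
  interpret nonassoc_algebra s P by fact
  have b: "basis_pair s f g" using T by (simp add: has_table_def)
  obtain e n \<epsilon> \<alpha> \<beta> \<delta> where N: "normal_table s P e n \<epsilon> \<alpha> \<beta> \<delta>"
    using assms(2) by (auto simp: normalizable_def split: prod.splits)
  obtain x y where n: "n = comb s f g (x, y)" using comb_cases[OF b] .
  have n0: "n = comb s e n (0, 1)" "basis_pair s e n" "P n n = 0"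
    using N by (auto simp: has_table_def comb_pair)
  then have "n \<noteq> 0" using comb_eq_0_iff[of e n "(0, 1)"] by simp
  moreover have "x = 0" "y = 0"
    using n0(3) unfolding n mult_comb[OF T] comb_eq_0_iff[OF b] by simp_all
  ultimately show False by (simp add: n comb_0)
qed

text \<open>A consequence of \<open>normal_table_unique\<close> that no longer mentions the change of basis.\<close>

fun similar_params :: "'k::field \<times> 'k \<times> 'k \<times> 'k \<Rightarrow> 'k \<times> 'k \<times> 'k \<times> 'k \<Rightarrow> bool" where
  "similar_params (\<epsilon>, \<alpha>, \<beta>, \<delta>) (\<epsilon>', \<alpha>', \<beta>', \<delta>') \<longleftrightarrow>
    \<epsilon> * \<alpha>' = \<alpha> * \<epsilon>' \<and> \<epsilon> * \<beta>' = \<beta> * \<epsilon>' \<and> \<alpha> * \<beta>' = \<beta> * \<alpha>' \<and>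
    (\<epsilon> = 0 \<longleftrightarrow> \<epsilon>' = 0) \<and> (\<alpha> = 0 \<longleftrightarrow> \<alpha>' = 0) \<and> (\<beta> = 0 \<longleftrightarrow> \<beta>' = 0) \<and>
    (\<alpha> + \<beta> = \<epsilon> \<longrightarrow> (\<delta> = 0 \<longleftrightarrow> \<delta>' = 0))"

lemma similar_params_imp_eq:
  fixes t t' :: "'k::field_char_0 terminal_name"
  assumes "admissible t" "admissible t'" "t \<noteq> T09" "t' \<noteq> T09"
    and "similar_params (params t) (params t')"
  shows "t = t'"
proof -
  have *: "3 - 2 * a = 1 - a \<longleftrightarrow> a = 2" "1 - a = 3 - 2 * a \<longleftrightarrow> a = 2"
    "2 * a = 3 \<longleftrightarrow> a * 2 = 3" "3 = 2 * a \<longleftrightarrow> a * 2 = 3" for a :: 'k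
    by (auto simp: algebra_simps)
  show ?thesis
    using assms by (induct t; induct t') (auto simp: *)
qed

lemma terminal_mult_not_iso:
  fixes t t' :: "'k::field_char_0 terminal_name"
  assumes "admissible t" "admissible t'" "t \<noteq> t'"
  shows "\<not> algebra_iso (*s) (terminal_mult t) (*s) (terminal_mult t')"
proof
  assume "algebra_iso (*s) (terminal_mult t) (*s) (terminal_mult t')"
  then obtain f where f: "Vector_Spaces.linear (*s) (*s) f" "bij f"
    "\<And>x y. f (terminal_mult t x y) = terminal_mult t' (f x) (f y)"
    unfolding algebra_iso_def by blast
  have transport: "has_table (*s) (terminal_mult t') (f u) (f v) A B C D"
    if "has_table (*s) (terminal_mult t) u v A B C D" for u v A B C D
    using has_table_iso[of "(*s)" "(*s)" f "terminal_mult t" "terminal_mult t'"] f that by blast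
  note alg = nonassoc_algebra_terminal_mult
  have N: "normalizable (*s) (terminal_mult t') (params t)" if "t \<noteq> T09"
    using normalizable_terminal_mult[OF that] transport
    by (fastforce simp: normalizable_def split: prod.splits)
  note N' = normalizable_terminal_mult[of t']
  show False
  proof (cases "t = T09 \<or> t' = T09")
    case True
    then have "\<exists>f g. idempotent_table (*s) (terminal_mult t') f g"
      using idempotent_table_terminal_mult transport by metis
    moreover have "\<exists>x. normalizable (*s) (terminal_mult t') x"
      using True assms(3) N N' by metis
    ultimately show False
      using normalizable_not_idempotent_table[OF alg] by blast
  next
    case False
    obtain \<epsilon> \<alpha> \<beta> \<delta> where p: "params t = (\<epsilon>, \<alpha>, \<beta>, \<delta>)" using prod_cases4 .
    obtain \<epsilon>' \<alpha>' \<beta>' \<delta>' where p': "params t' = (\<epsilon>', \<alpha>', \<beta>', \<delta>')" using prod_cases4 .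
    have "(\<epsilon>, \<alpha>, \<beta>, \<delta>) \<noteq> (0, 0, 0, 0)"
      using p False by (cases t) auto
    then obtain q r s where rel: "q \<noteq> 0" "r \<noteq> 0" "\<epsilon>' = q * \<epsilon>" "\<alpha>' = q * \<alpha>" "\<beta>' = q * \<beta>"
      "\<delta>' * r = q\<^sup>2 * \<delta> + q * s * (\<alpha> + \<beta> - \<epsilon>)"
      using N N' False normal_table_unique[OF alg] unfolding normalizable_def p p' prod.case by meson
    have "\<delta> = 0 \<longleftrightarrow> \<delta>' = 0" if "\<alpha> + \<beta> = \<epsilon>"
    proof -
      have "\<delta>' * r = q\<^sup>2 * \<delta>" using rel(6) that by simp
      then show ?thesis using rel(1,2) by (metis mult_eq_0_iff power_not_zero)
    qed
    with rel(1-5) have "similar_params (params t) (params t')"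
      unfolding p p' by simp
    with assms False show False
      using similar_params_imp_eq[of t t'] by simp
  qed
qed

theorem theorem12:
  fixes scale :: "'k::{alg_closed_field, field_char_0} \<Rightarrow> 'v::ab_group_add \<Rightarrow> 'v"
    and P :: "'v \<Rightarrow> 'v \<Rightarrow> 'v"
  assumes "nonassoc_algebra scale P"
    and "vector_space.dim scale (UNIV :: 'v set) = 2"
    and "terminal P"
    and "P \<noteq> (\<lambda>x y. 0)"
  shows "(\<exists>t :: 'k terminal_name. admissible t \<and> algebra_iso scale P (*s) (terminal_mult t)) \<and>
    (\<forall>(s :: 'k terminal_name) t. admissible s \<and> admissible t \<and> s \<noteq> t \<longrightarrow>
       \<not> algebra_iso (*s) (terminal_mult s) (*s) (terminal_mult t))"
proof
  from normal_or_idempotent_table[OF assms(1-3)]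
  show "\<exists>t :: 'k terminal_name. admissible t \<and> algebra_iso scale P (*s) (terminal_mult t)"
  proof
    assume "\<exists>e n \<epsilon> \<alpha> \<beta> \<delta>. normal_table scale P e n \<epsilon> \<alpha> \<beta> \<delta>"
    then show ?thesis
      using normalizable_terminal[OF assms(1) _ assms(3,4)]
        normalizable_iso_terminal_mult[OF assms(1)] by metis
  next
    assume "\<exists>e f. idempotent_table scale P e f"
    then have "algebra_iso scale P (*s) (terminal_mult T09)"
      using algebra_iso_table[OF assms(1) _ nonassoc_algebra_terminal_mult
          idempotent_table_terminal_mult] by blast
    then show ?thesis by (intro exI[of _ T09]) simp
  qed
qed (use terminal_mult_not_iso in blast)

end
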